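(* Let $G$ and $H$ be simple connected graphs. Then the Cartesian product $G \Box H$ and the Kronecker product $G \otimes H$ are isomorphic if and only if $G$ and $H$ are odd cycles of the same length.
   Context: All graphs are finite, undirected and simple (no loops or multiple edges). An odd cycle is a cycle graph $C_n$ on $n$ vertices with $n \ge 3$ odd; its length is $n$. For graphs $G$ and $H$, the following products have vertex set $V(G)\times V(H)$. The Cartesian product $G \Box H$: $(x,y)\sim(x',y')$ if either ($x\sim x'$ in $G$ and $y=y'$) or ($x=x'$ and $y\sim y'$ in $H$). The Kronecker (direct) product $G\otimes H$: $(x,y)\sim(x',y')$ if $x\sim x'$ in $G$ and $y\sim y'$ in $H$. Two graphs are isomorphic if there is a bijection between their vertex sets such that two vertices are adjacent in the first graph if and only if their images are adjacent in the second.
   Formalization: The case where G and H are both the one-vertex graph is excluded: there both products are a single vertex, hence isomorphic, although a single vertex is not an odd cycle. *)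

theory Defs
  imports "Graph_Theory.Graph_Theory"
begin

text \<open>
  Finite simple undirected graphs are \<open>pair_graph\<close>s of the entry Graph_Theory: finite, symmetric and
  loop-free, an undirected edge being represented by both of its orientations. For such graphs
  \<open>digraph_iso\<close> is the usual isomorphism of simple graphs, see \<open>digraph_iso_pair_iff\<close>.
\<close>

definition cartesian_product ::
    "'a pair_pre_digraph \<Rightarrow> 'b pair_pre_digraph \<Rightarrow> ('a \<times> 'b) pair_pre_digraph" where
  "cartesian_product G H =
    \<lparr> pverts = pverts G \<times> pverts H,
      parcs = {((x, y), (x', y')) | x y x' y'.
        ((x, x') \<in> parcs G \<and> y \<in> pverts H \<and> y = y') \<or>
        (x \<in> pverts G \<and> x = x' \<and> (y, y') \<in> parcs H)} \<rparr>"

definition kronecker_product ::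
    "'a pair_pre_digraph \<Rightarrow> 'b pair_pre_digraph \<Rightarrow> ('a \<times> 'b) pair_pre_digraph" where
  "kronecker_product G H =
    \<lparr> pverts = pverts G \<times> pverts H,
      parcs = {((x, y), (x', y')) | x y x' y'. (x, x') \<in> parcs G \<and> (y, y') \<in> parcs H} \<rparr>"

text \<open>The cycle \<open>C\<^sub>n\<close> on the residues modulo \<open>n\<close>; only meaningful for \<open>n \<ge> 3\<close>.\<close>

definition cycle_graph :: "nat \<Rightarrow> nat pair_pre_digraph" where
  "cycle_graph n =
    \<lparr> pverts = {..<n},
      parcs = {(i, j). i < n \<and> j < n \<and> (j = Suc i mod n \<or> i = Suc j mod n)} \<rparr>"

definition odd_cycle_of_length :: "nat \<Rightarrow> 'a pair_pre_digraph \<Rightarrow> bool" where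
  "odd_cycle_of_length n G \<longleftrightarrow>
    n \<ge> 3 \<and> odd n \<and> digraph_iso (with_proj G) (with_proj (cycle_graph n))"

lemma pair_graph_iff:
  "pair_graph G \<longleftrightarrow>
    finite (pverts G) \<and> parcs G \<subseteq> pverts G \<times> pverts G \<and> sym (parcs G) \<and> irrefl (parcs G)"
proof
  assume "pair_graph G"
  then interpret pair_graph G .
  show "finite (pverts G) \<and> parcs G \<subseteq> pverts G \<times> pverts G \<and> sym (parcs G) \<and> irrefl (parcs G)"
    using pair_finite_verts in_arcsD1 in_arcsD2 arcs_symmetric no_loops'
    by (auto intro!: symI simp: irrefl_def) blast
next
  assume A: "finite (pverts G) \<and> parcs G \<subseteq> pverts G \<times> pverts G \<and> sym (parcs G) \<and> irrefl (parcs G)"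
  then have "finite (parcs G)"
    by (meson finite_SigmaI finite_subset)
  with A show "pair_graph G"
    by unfold_locales (auto simp: symmetric_def irrefl_def)
qed

lemma pair_graph_cartesian_product:
  assumes "pair_graph G" "pair_graph H"
  shows "pair_graph (cartesian_product G H)"
  using assms unfolding pair_graph_iff
  by (auto simp: cartesian_product_def irrefl_def intro!: symI dest: symD)

lemma pair_graph_kronecker_product:
  assumes "pair_graph G" "pair_graph H"
  shows "pair_graph (kronecker_product G H)"
  using assms unfolding pair_graph_iff
  by (auto simp: kronecker_product_def irrefl_def intro!: symI dest: symD)

lemma pair_graph_cycle_graph:
  assumes "n \<ge> 3"
  shows "pair_graph (cycle_graph n)"
  using assms unfolding pair_graph_iff
  by (auto simp: cycle_graph_def irrefl_def mod_Suc intro!: symI split: if_splits)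

lemma digraph_iso_pair_iff:
  assumes "pair_graph G" "pair_graph H"
  shows "digraph_iso (with_proj G) (with_proj H) \<longleftrightarrow>
    (\<exists>f. bij_betw f (pverts G) (pverts H) \<and>
      (\<forall>u\<in>pverts G. \<forall>v\<in>pverts G. (u, v) \<in> parcs G \<longleftrightarrow> (f u, f v) \<in> parcs H))"
    (is "?L \<longleftrightarrow> ?R")
proof
  interpret G: pair_graph G by fact
  assume ?L
  then obtain h where h: "pre_digraph.digraph_isomorphism (with_proj G) h"
    and H: "with_proj H = app_iso h (with_proj G)"
    by (auto simp: digraph_iso_def)
  define f where "f = iso_verts h"
  have verts: "pverts H = f ` pverts G" and arcs: "parcs H = iso_arcs h ` parcs G"
    and hd: "iso_head h = snd" "iso_tail h = fst"
    using arg_cong[OF H, of verts] arg_cong[OF H, of arcs] arg_cong[OF H, of head]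
      arg_cong[OF H, of tail] by (simp_all add: f_def)
  have inj: "inj_on f (pverts G)"
    and ends: "\<And>a. a \<in> parcs G \<Longrightarrow> iso_arcs h a = (f (fst a), f (snd a))"
    using h by (auto simp: pre_digraph.digraph_isomorphism_def f_def hd prod_eq_iff)
  have arcs': "parcs H = (\<lambda>a. (f (fst a), f (snd a))) ` parcs G"
    unfolding arcs using ends by (rule image_cong[OF refl])
  have "(u, v) \<in> parcs G \<longleftrightarrow> (f u, f v) \<in> parcs H" if "u \<in> pverts G" "v \<in> pverts G" for u v
    using that inj unfolding arcs'
    by (auto simp: image_iff Bex_def dest: G.in_arcsD1 G.in_arcsD2 inj_onD)
  with inj verts show ?R
    by (auto simp: bij_betw_def)
next
  interpret G: pair_graph G by fact
  interpret H: pair_graph H by fact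
  assume ?R
  then obtain f where bij: "bij_betw f (pverts G) (pverts H)"
    and adj: "\<And>u v. u \<in> pverts G \<Longrightarrow> v \<in> pverts G \<Longrightarrow> (u, v) \<in> parcs G \<longleftrightarrow> (f u, f v) \<in> parcs H"
    by blast
  define h where "h = \<lparr>iso_verts = f, iso_arcs = map_prod f f, iso_head = snd, iso_tail = fst\<rparr>"
  have inj: "inj_on f (pverts G)" and im: "f ` pverts G = pverts H"
    using bij by (auto simp: bij_betw_def)
  have "inj_on (map_prod f f) (parcs G)"
    by (rule inj_on_subset[OF map_prod_inj_on[OF inj inj]]) (auto dest: G.in_arcsD1 G.in_arcsD2)
  then have "pre_digraph.digraph_isomorphism (with_proj G) h"
    using inj G.wf_digraph by (auto simp: pre_digraph.digraph_isomorphism_def h_def)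
  moreover have "map_prod f f ` parcs G = parcs H"
  proof (intro equalityI subsetI)
    fix e assume "e \<in> map_prod f f ` parcs G"
    then show "e \<in> parcs H" using adj by (auto dest: G.in_arcsD1 G.in_arcsD2)
  next
    fix e assume e: "e \<in> parcs H"
    then have "fst e \<in> f ` pverts G" "snd e \<in> f ` pverts G"
      by (simp_all add: im H.arc_fst_in_verts H.arc_snd_in_verts)
    then obtain u v where "u \<in> pverts G" "v \<in> pverts G" "e = (f u, f v)"
      by (metis imageE prod.collapse)
    with e adj show "e \<in> map_prod f f ` parcs G" by force
  qed
  then have "with_proj H = app_iso h (with_proj G)"
    by (simp add: app_iso_def h_def with_proj_def im)
  ultimately show ?L by (auto simp: digraph_iso_def)
qed

end

theory Submission
  imports Defs "HOL-Number_Theory.Cong"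
begin

text \<open>
  In the Cartesian product degrees add, in the Kronecker product they multiply. Comparing the
  minimum degrees, and then the maximum degrees, of two isomorphic products gives
  \<open>a + b = a * b\<close>, hence \<open>a = b = 2\<close>; so both factors are cycles \<open>C\<^sub>m\<close> and \<open>C\<^sub>n\<close>. A copy of
  one factor in the Cartesian product projects from the Kronecker product to the other factor, so
  there are homomorphisms between \<open>C\<^sub>m\<close> and \<open>C\<^sub>n\<close> in both directions; if one of the lengths is odd,
  both are, and they are equal. Both cannot be even, since the Kronecker product of two bipartite
  graphs is disconnected. Conversely \<open>(x, y) \<mapsto> (x + y, x - y)\<close> is an isomorphism modulo odd \<open>n\<close>.
\<close>

subsection \<open>Pair graphs\<close>

abbreviation nbs :: "'a pair_pre_digraph \<Rightarrow> 'a \<Rightarrow> 'a set" where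
  "nbs G v \<equiv> parcs G `` {v}"

abbreviation deg :: "'a pair_pre_digraph \<Rightarrow> 'a \<Rightarrow> nat" where
  "deg G v \<equiv> card (nbs G v)"

lemma
  assumes "pair_graph G" and "(u, v) \<in> parcs G"
  shows pair_graph_tail_in_verts: "u \<in> pverts G"
    and pair_graph_head_in_verts: "v \<in> pverts G"
    and pair_graph_arc_sym: "(v, u) \<in> parcs G"
    and pair_graph_arc_neq: "u \<noteq> v"
  using assms unfolding pair_graph_iff by (auto dest: symD simp: irrefl_def)

lemma pair_graph_finite_verts: "pair_graph G \<Longrightarrow> finite (pverts G)"
  by (simp add: pair_graph_iff)

lemma pair_graph_nbs_subset: "pair_graph G \<Longrightarrow> nbs G v \<subseteq> pverts G"
  by (auto dest: pair_graph_head_in_verts)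

lemma pair_graph_finite_nbs: "pair_graph G \<Longrightarrow> finite (nbs G v)"
  by (meson finite_subset pair_graph_finite_verts pair_graph_nbs_subset)

section \<open>Connectedness of symmetric graphs\<close>

lemma connected_verts_nonempty:
  "connected (with_proj G) \<Longrightarrow> pverts G \<noteq> {}"
  by (auto simp: connected_def strongly_connected_def)

text \<open>\<open>connected\<close> speaks of reachability in the symmetric closure. As
  \<open>parcs G\<close> is symmetric already, every step of such a path is an arc of
  \<open>G\<close>.\<close>

lemma connected_induct [consumes 4, case_names base step]:
  assumes "pair_graph G" "connected (with_proj G)" "u \<in> pverts G" "v \<in> pverts G"
    and "P u" and step: "\<And>x y. (x, y) \<in> parcs G \<Longrightarrow> P x \<Longrightarrow> P y"
  shows "P v"
proof -
  interpret pair_graph G by fact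
  have "u \<rightarrow>\<^sup>*\<^bsub>mk_symmetric (with_proj G)\<^esub> v"
    using assms(2-4) by (simp add: connected_def strongly_connected_def)
  then have "(u, v) \<in> rtrancl_on (pverts G) (parcs (mk_symmetric (with_proj G)))"
    by (simp add: reachable_def)
  then show ?thesis
  proof (induction rule: rtrancl_on_induct)
    case (step y z)
    then have "(y, z) \<in> parcs G"
      using pair_graph_arc_sym[OF assms(1)] by (auto simp: mk_symmetric_def)
    with step show ?case using assms(6) by blast
  qed (use assms in auto)
qed

lemma connected_constant:
  assumes "pair_graph G" "connected (with_proj G)"
    and "\<And>x y. (x, y) \<in> parcs G \<Longrightarrow> c x = c y" and "u \<in> pverts G" "v \<in> pverts G"
  shows "c u = c v"
  using assms(1,2,4,5) by (induction rule: connected_induct) (auto dest: assms(3))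

text \<open>Induction with the property of being \<open>u\<close>: the step case is vacuous, as no
  arc leaves \<open>u\<close>.\<close>

lemma connected_isolated_vertex:
  assumes "pair_graph G" "connected (with_proj G)" and "u \<in> pverts G" "nbs G u = {}"
  shows "pverts G = {u}"
proof -
  have "v = u" if "v \<in> pverts G" for v
    using assms(1-3) that by (induction rule: connected_induct) (use assms(4) in auto)
  with assms(3) show ?thesis by blast
qed

section \<open>Isomorphisms as vertex bijections\<close>

text \<open>The vertex map is an explicit argument, so that it can be inverted, composed and
  evaluated. Arcs are pairs of vertices, so no separate arc map is carried along.\<close>

definition pair_iso ::
    "('a \<Rightarrow> 'b) \<Rightarrow> 'a pair_pre_digraph \<Rightarrow> 'b pair_pre_digraph \<Rightarrow> bool" where
  "pair_iso f G H \<longleftrightarrow> bij_betw f (pverts G) (pverts H) \<and>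
    (\<forall>u\<in>pverts G. \<forall>v\<in>pverts G. (u, v) \<in> parcs G \<longleftrightarrow> (f u, f v) \<in> parcs H)"

lemma digraph_iso_iff_pair_iso:
  assumes "pair_graph G" "pair_graph H"
  shows "digraph_iso (with_proj G) (with_proj H) \<longleftrightarrow> (\<exists>f. pair_iso f G H)"
  using digraph_iso_pair_iff[OF assms] by (simp add: pair_iso_def)

lemma pair_iso_inv:
  assumes "pair_iso f G H"
  shows "pair_iso (the_inv_into (pverts G) f) H G"
proof -
  have bij: "bij_betw f (pverts G) (pverts H)"
    using assms by (simp add: pair_iso_def)
  then have "bij_betw (the_inv_into (pverts G) f) (pverts H) (pverts G)"
    by (rule bij_betw_the_inv_into)
  moreover from this have "the_inv_into (pverts G) f x \<in> pverts G" if "x \<in> pverts H" for x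
    using that by (auto dest: bij_betwE)
  ultimately show ?thesis
    using assms bij by (auto simp: pair_iso_def f_the_inv_into_f_bij_betw)
qed

lemma pair_iso_comp:
  assumes "pair_iso f G H" "pair_iso g H K"
  shows "pair_iso (g \<circ> f) G K"
  using assms unfolding pair_iso_def by (auto intro: bij_betw_trans dest: bij_betwE)

lemma pair_iso_in_verts: "pair_iso f G H \<Longrightarrow> v \<in> pverts G \<Longrightarrow> f v \<in> pverts H"
  by (auto simp: pair_iso_def dest: bij_betwE)

lemma pair_iso_surj: "pair_iso f G H \<Longrightarrow> w \<in> pverts H \<Longrightarrow> \<exists>v\<in>pverts G. w = f v"
  by (auto simp: pair_iso_def bij_betw_def)

lemma pair_iso_arc:
  assumes "pair_iso f G H" "pair_graph G" "(u, v) \<in> parcs G"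
  shows "(f u, f v) \<in> parcs H"
  using assms by (auto simp: pair_iso_def dest: pair_graph_tail_in_verts pair_graph_head_in_verts)

lemma pair_iso_deg:
  assumes "pair_iso f G H" "pair_graph G" "pair_graph H" "v \<in> pverts G"
  shows "deg H (f v) = deg G v"
proof -
  have "nbs H (f v) = f ` nbs G v"
  proof (intro equalityI subsetI)
    fix y assume y: "y \<in> nbs H (f v)"
    then obtain u where "u \<in> pverts G" "y = f u"
      using pair_iso_surj[OF assms(1)] pair_graph_nbs_subset[OF assms(3)] by blast
    with y assms show "y \<in> f ` nbs G v" by (auto simp: pair_iso_def)
  qed (use assms in \<open>auto dest: pair_iso_arc\<close>)
  moreover have "inj_on f (nbs G v)"
    using assms inj_on_subset[OF _ pair_graph_nbs_subset] by (auto simp: pair_iso_def bij_betw_def)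
  ultimately show ?thesis by (simp add: card_image)
qed

subsection \<open>Products\<close>

lemma pverts_cartesian_product [simp]:
  "pverts (cartesian_product G H) = pverts G \<times> pverts H"
  by (simp add: cartesian_product_def)

lemma pverts_kronecker_product [simp]:
  "pverts (kronecker_product G H) = pverts G \<times> pverts H"
  by (simp add: kronecker_product_def)

lemma parcs_cartesian_product_iff [simp]:
  "((x, y), (x', y')) \<in> parcs (cartesian_product G H) \<longleftrightarrow>
    (x, x') \<in> parcs G \<and> y \<in> pverts H \<and> y = y' \<or> x \<in> pverts G \<and> x = x' \<and> (y, y') \<in> parcs H"
  by (simp add: cartesian_product_def)

lemma parcs_kronecker_product_iff [simp]:
  "((x, y), (x', y')) \<in> parcs (kronecker_product G H) \<longleftrightarrow>
    (x, x') \<in> parcs G \<and> (y, y') \<in> parcs H"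
  by (simp add: kronecker_product_def)

text \<open>The copies of the two neighbourhoods are disjoint: a common element would be
  \<open>(x, y)\<close> itself, making \<open>x\<close> its own neighbour.\<close>

lemma deg_cartesian_product:
  assumes "pair_graph G" "pair_graph H" "x \<in> pverts G" "y \<in> pverts H"
  shows "deg (cartesian_product G H) (x, y) = deg G x + deg H y"
proof -
  have "nbs (cartesian_product G H) (x, y) = nbs G x \<times> {y} \<union> {x} \<times> nbs H y"
    using assms by auto
  moreover have "(nbs G x \<times> {y}) \<inter> ({x} \<times> nbs H y) = {}"
    using assms(1) by (auto dest: pair_graph_arc_neq)
  ultimately show ?thesis
    using assms(1,2) by (simp add: card_Un_disjoint pair_graph_finite_nbs card_cartesian_product)
qed

lemma deg_kronecker_product: "deg (kronecker_product G H) (x, y) = deg G x * deg H y"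
proof -
  have "nbs (kronecker_product G H) (x, y) = nbs G x \<times> nbs H y"
    by auto
  then show ?thesis by (simp add: card_cartesian_product)
qed

lemma pair_iso_cartesian_product:
  assumes f: "pair_iso f G G'" and g: "pair_iso g H H'"
  shows "pair_iso (map_prod f g) (cartesian_product G H) (cartesian_product G' H')"
proof -
  have "bij_betw f (pverts G) (pverts G')" "bij_betw g (pverts H) (pverts H')"
    using f g by (simp_all add: pair_iso_def)
  moreover from this have "inj_on f (pverts G)" "inj_on g (pverts H)"
    by (simp_all add: bij_betw_def)
  ultimately show ?thesis
    using f g by (auto simp: pair_iso_def bij_betw_map_prod inj_on_eq_iff dest: bij_betwE)
qed

lemma pair_iso_kronecker_product:
  assumes "pair_iso f G G'" and "pair_iso g H H'"
  shows "pair_iso (map_prod f g) (kronecker_product G H) (kronecker_product G' H')"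
  using assms by (auto simp: pair_iso_def bij_betw_map_prod)

text \<open>Connectedness of the Cartesian product, in terms of invariants: go from \<open>p\<close>
  to \<open>q\<close> first along a copy of \<open>G\<close>, then along a copy of
  \<open>H\<close>.\<close>

lemma cartesian_product_constant:
  assumes G: "pair_graph G" "connected (with_proj G)"
    and H: "pair_graph H" "connected (with_proj H)"
    and c: "\<And>p q. (p, q) \<in> parcs (cartesian_product G H) \<Longrightarrow> c p = c q"
    and "p \<in> pverts G \<times> pverts H" "q \<in> pverts G \<times> pverts H"
  shows "c p = c q"
proof -
  obtain x y x' y' where pq: "p = (x, y)" "q = (x', y')"
    by (cases p, cases q)
  with assms have V: "x \<in> pverts G" "y \<in> pverts H" "x' \<in> pverts G" "y' \<in> pverts H"
    by auto
  have "c (x, y) = c (x', y)"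
    by (rule connected_constant[OF G, where c = "\<lambda>x. c (x, y)"]) (use c V in auto)
  also have "\<dots> = c (x', y')"
    by (rule connected_constant[OF H, where c = "\<lambda>y. c (x', y)"]) (use c V in auto)
  finally show ?thesis using pq by simp
qed

subsection \<open>Degrees of the factors\<close>

text \<open>With \<open>a = c + 1\<close> and \<open>b = d + 1\<close> the equation becomes
  \<open>c * d = 1\<close>.\<close>

lemma add_eq_mult_nat:
  fixes a b :: nat
  assumes "a + b = a * b"
  shows "a = 0 \<and> b = 0 \<or> a = 2 \<and> b = 2"
proof (cases "a = 0 \<or> b = 0")
  case False
  then obtain c d where "a = Suc c" "b = Suc d"
    by (metis not0_implies_Suc)
  with assms have "c * d = 1" by simp
  then show ?thesis using \<open>a = Suc c\<close> \<open>b = Suc d\<close> by simp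
qed (use assms in auto)

lemma two_regular_if_iso_products:
  assumes G: "pair_graph G" "connected (with_proj G)"
    and H: "pair_graph H" "connected (with_proj H)"
    and nontriv: "\<not> (card (pverts G) = 1 \<and> card (pverts H) = 1)"
    and iso: "pair_iso f (cartesian_product G H) (kronecker_product G H)"
  shows "(\<forall>x\<in>pverts G. deg G x = 2) \<and> (\<forall>y\<in>pverts H. deg H y = 2)"
proof -
  let ?dG = "deg G ` pverts G" and ?dH = "deg H ` pverts H"
  have fin: "finite ?dG" "finite ?dH" and ne: "?dG \<noteq> {}" "?dH \<noteq> {}"
    using G H by (simp_all add: pair_graph_finite_verts connected_verts_nonempty)
  have deg_iso: "deg (kronecker_product G H) (f (x, y)) = deg G x + deg H y"
    if "x \<in> pverts G" "y \<in> pverts H" for x y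
    using that pair_iso_deg[OF iso] G(1) H(1)
    by (simp add: pair_graph_cartesian_product pair_graph_kronecker_product deg_cartesian_product)
  \<comment> \<open>Together with \<open>prod_to_sum\<close> below: sums and products of degrees run
    over the same set of values, so they have the same least and the same greatest value.\<close>
  have sum_to_prod: "\<exists>x'\<in>pverts G. \<exists>y'\<in>pverts H. deg G x + deg H y = deg G x' * deg H y'"
    if "x \<in> pverts G" "y \<in> pverts H" for x y
  proof -
    obtain x' y' where "f (x, y) = (x', y')" by (cases "f (x, y)")
    moreover have "f (x, y) \<in> pverts G \<times> pverts H"
      using pair_iso_in_verts[OF iso] that by simp
    ultimately show ?thesis
      using deg_iso[OF that] by (intro bexI[of _ x'] bexI[of _ y']) (simp_all add: deg_kronecker_product)
  qed
  have prod_to_sum: "\<exists>x\<in>pverts G. \<exists>y\<in>pverts H. deg G x' * deg H y' = deg G x + deg H y"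
    if "x' \<in> pverts G" "y' \<in> pverts H" for x' y'
  proof -
    obtain x y where "x \<in> pverts G" "y \<in> pverts H" "(x', y') = f (x, y)"
      using pair_iso_surj[OF iso, of "(x', y')"] \<open>x' \<in> pverts G\<close> \<open>y' \<in> pverts H\<close> by auto
    then show ?thesis
      using deg_iso[of x y] deg_kronecker_product[of G H x' y'] by (intro bexI[of _ x] bexI[of _ y]) simp_all
  qed
  define a A b B where "a = Min ?dG" "A = Max ?dG" "b = Min ?dH" "B = Max ?dH"
  note defs = this
  have bd: "a \<le> deg G x" "deg G x \<le> A" if "x \<in> pverts G" for x
    using that fin by (simp_all add: defs)
  have bdH: "b \<le> deg H y" "deg H y \<le> B" if "y \<in> pverts H" for y
    using that fin by (simp_all add: defs)
  obtain x y where x: "x \<in> pverts G" "deg G x = a" and y: "y \<in> pverts H" "deg H y = b"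
    using Min_in[OF fin(1) ne(1)] Min_in[OF fin(2) ne(2)] by (auto simp: defs)
  obtain x' y' where x': "x' \<in> pverts G" "deg G x' = A" and y': "y' \<in> pverts H" "deg H y' = B"
    using Max_in[OF fin(1) ne(1)] Max_in[OF fin(2) ne(2)] by (auto simp: defs)
  have lower: "a * b \<le> deg G u * deg H v" "a + b \<le> deg G u + deg H v"
    and upper: "deg G u * deg H v \<le> A * B" "deg G u + deg H v \<le> A + B"
    if "u \<in> pverts G" "v \<in> pverts H" for u v
    using that bd bdH by (simp_all add: mult_le_mono add_mono)
  have "a * b \<le> a + b"
  proof -
    obtain u v where "u \<in> pverts G" "v \<in> pverts H" "deg G x + deg H y = deg G u * deg H v"
      using sum_to_prod[OF x(1) y(1)] by blast
    with lower(1)[of u v] x(2) y(2) show ?thesis by simp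
  qed
  moreover have "a + b \<le> a * b"
  proof -
    obtain u v where "u \<in> pverts G" "v \<in> pverts H" "deg G x * deg H y = deg G u + deg H v"
      using prod_to_sum[OF x(1) y(1)] by blast
    with lower(2)[of u v] x(2) y(2) show ?thesis by simp
  qed
  ultimately have min: "a = 0 \<and> b = 0 \<or> a = 2 \<and> b = 2"
    by (intro add_eq_mult_nat) simp
  have "A + B \<le> A * B"
  proof -
    obtain u v where "u \<in> pverts G" "v \<in> pverts H" "deg G x' + deg H y' = deg G u * deg H v"
      using sum_to_prod[OF x'(1) y'(1)] by blast
    with upper(1)[of u v] x'(2) y'(2) show ?thesis by simp
  qed
  moreover have "A * B \<le> A + B"
  proof -
    obtain u v where "u \<in> pverts G" "v \<in> pverts H" "deg G x' * deg H y' = deg G u + deg H v"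
      using prod_to_sum[OF x'(1) y'(1)] by blast
    with upper(2)[of u v] x'(2) y'(2) show ?thesis by simp
  qed
  ultimately have max: "A = 0 \<and> B = 0 \<or> A = 2 \<and> B = 2"
    by (intro add_eq_mult_nat) simp
  \<comment> \<open>Minimum degree 0 on both sides gives an isolated vertex in each factor, so by
    connectedness both factors are single vertices, which \<open>nontriv\<close> excludes.\<close>
  have "\<not> (a = 0 \<and> b = 0)"
  proof
    assume "a = 0 \<and> b = 0"
    then have "nbs G x = {}" "nbs H y = {}"
      using x y G(1) H(1) by (simp_all add: pair_graph_finite_nbs)
    from connected_isolated_vertex[OF G x(1) this(1)] connected_isolated_vertex[OF H y(1) this(2)]
    have "pverts G = {x}" "pverts H = {y}" .
    with nontriv show False by simp
  qed
  then have a: "a = 2" "b = 2" using min by auto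
  have A: "A \<le> 2" "B \<le> 2" using max by auto
  have "deg G u = 2" if "u \<in> pverts G" for u
    using bd[OF that] a A by simp
  moreover have "deg H v = 2" if "v \<in> pverts H" for v
    using bdH[OF that] a A by simp
  ultimately show ?thesis by blast
qed

subsection \<open>Cycles\<close>

lemma parcs_cycle_graph_iff [simp]:
  "(i, j) \<in> parcs (cycle_graph n) \<longleftrightarrow> i < n \<and> j < n \<and> (j = Suc i mod n \<or> i = Suc j mod n)"
  by (simp add: cycle_graph_def)

lemma pverts_cycle_graph [simp]: "pverts (cycle_graph n) = {..<n}"
  by (simp add: cycle_graph_def)

text \<open>Walk through \<open>G\<close> without turning back. By finiteness the walk repeats a
  vertex; the first repetition can only be a return to the start. The closed walk is all of
  \<open>G\<close>, since its vertex set is closed under taking neighbours.\<close>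

lemma connected_two_regular_imp_cycle:
  assumes G: "pair_graph G" "connected (with_proj G)"
    and two: "\<And>x. x \<in> pverts G \<Longrightarrow> deg G x = 2"
  shows "\<exists>n f. n \<ge> 3 \<and> pair_iso f (cycle_graph n) G"
proof -
  have two_nbs: "\<exists>p q. p \<noteq> q \<and> nbs G x = {p, q}" if "x \<in> pverts G" for x
    using two[OF that] by (auto simp: card_2_iff)
  obtain v0 where v0: "v0 \<in> pverts G"
    using connected_verts_nonempty[OF G(2)] by auto
  obtain v1 where v1: "(v0, v1) \<in> parcs G"
    using two_nbs[OF v0] by blast
  define other where "other u v = (SOME w. (v, w) \<in> parcs G \<and> w \<noteq> u)" for u v
  have other: "(v, other u v) \<in> parcs G \<and> other u v \<noteq> u" if "v \<in> pverts G" for u v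
  proof -
    have "\<exists>p q. p \<noteq> q \<and> nbs G v = {p, q}" using two_nbs that by blast
    then have "\<exists>w. (v, w) \<in> parcs G \<and> w \<noteq> u" by blast
    then show ?thesis unfolding other_def by (rule someI_ex)
  qed
  \<comment> \<open>The state holds the last two vertices, as the next one depends on both.\<close>
  define s where "s = rec_nat (v0, v1) (\<lambda>_ (u, v). (v, other u v))"
  define w where "w k = fst (s k)" for k
  have s: "s k = (w k, w (Suc k))" for k
    by (simp add: w_def s_def case_prod_beta)
  have w_Suc: "w (Suc (Suc k)) = other (w k) (w (Suc k))" for k
    by (simp add: w_def) (simp add: s_def case_prod_beta)
  have w01: "w 0 = v0" "w (Suc 0) = v1"
    by (simp_all add: w_def s_def)
  have arc: "(w k, w (Suc k)) \<in> parcs G" for k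
  proof (induction k)
    case 0 show ?case using v1 by (simp add: w01)
  next
    case (Suc k)
    then show ?case
      using other[of "w (Suc k)" "w k"] pair_graph_head_in_verts[OF G(1)] by (simp add: w_Suc)
  qed
  have wV: "w k \<in> pverts G" for k
    using arc pair_graph_tail_in_verts[OF G(1)] by blast
  have skip: "w (Suc (Suc k)) \<noteq> w k" for k
    using other[OF wV] by (simp add: w_Suc)
  \<comment> \<open>The vertices before and after \<open>w (Suc k)\<close> are distinct neighbours
    of it, hence by regularity the only ones.\<close>
  have nbs_w: "nbs G (w (Suc k)) = {w k, w (Suc (Suc k))}" for k
    using two_nbs[OF wV, of "Suc k"] arc[of "Suc k"] pair_graph_arc_sym[OF G(1) arc[of k]] skip[of k]
    by (smt (verit) Image_singleton_iff doubleton_eq_iff insert_iff singletonD)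
  have repeat: "\<exists>n. \<exists>i<n. w n = w i"
  proof -
    have "finite (range w)"
      using wV finite_subset[OF _ pair_graph_finite_verts[OF G(1)]] by blast
    then have "\<not> inj w" using finite_imageD by blast
    then obtain i j where "w i = w j" "i \<noteq> j" by (auto simp: inj_def)
    then show ?thesis by (metis nat_neq_iff)
  qed
  \<comment> \<open>The first time at which a vertex recurs, so that \<open>w\<close> is injective
    below \<open>n\<close>.\<close>
  define n where "n = (LEAST n. \<exists>i<n. w n = w i)"
  obtain i where i: "i < n" "w n = w i"
    using LeastI_ex[OF repeat] unfolding n_def by blast
  have "\<not> (\<exists>i<m. w m = w i)" if "m < n" for m
    using not_less_Least that unfolding n_def by blast
  then have inj: "inj_on w {..<n}"
    by (metis (no_types, lifting) inj_onI lessThan_iff nat_neq_iff)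
  \<comment> \<open>\<open>n = 1\<close> would give a loop; \<open>n = 2\<close> would give a loop
    or a turning back, excluded by \<open>skip\<close>.\<close>
  have n3: "n \<ge> 3"
  proof -
    have "w (Suc k) \<noteq> w k" for k using pair_graph_arc_neq[OF G(1) arc[of k]] by simp
    then have "n \<noteq> Suc 0" "n \<noteq> Suc (Suc 0)"
      using i skip by (metis less_Suc0, metis less_Suc_eq less_Suc0)
    moreover have "n \<noteq> 0" using i by simp
    ultimately show ?thesis by linarith
  qed
  then obtain m where m: "n = Suc m" "m \<ge> 2" by (cases n) auto
  \<comment> \<open>For \<open>i > 0\<close>, the vertex \<open>w m\<close> is a neighbour of
    \<open>w n = w i\<close>, so it is \<open>w (i - 1)\<close> or \<open>w (i + 1)\<close>.
    Injectivity excludes the first; the second makes the walk turn back (\<open>m = i + 1\<close>)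
    or contain a loop (\<open>m = i\<close>).\<close>
  have i0: "i = 0"
  proof (rule ccontr)
    assume "i \<noteq> 0"
    then obtain j where j: "i = Suc j" by (cases i) auto
    have "(w i, w m) \<in> parcs G"
      using pair_graph_arc_sym[OF G(1) arc[of m]] i m by simp
    then have wm: "w m = w j \<or> w m = w (Suc i)"
      using nbs_w[of j] j by auto
    have "w m \<noteq> w j"
      using inj_onD[OF inj, of m j] i j m by auto
    then have wm: "w m = w (Suc i)" using wm by simp
    show False
    proof (cases "Suc i < n")
      case True
      then have "m = Suc i" using inj_onD[OF inj wm] m by simp
      then show False using skip[of i] i m by simp
    next
      case False
      then have "i = m" using i m by simp
      then show False using wm pair_graph_arc_neq[OF G(1) arc[of m]] by simp
    qed
  qed
  have wn: "w n = w 0" using i i0 by simp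
  have arc_m: "(w 0, w m) \<in> parcs G"
    using pair_graph_arc_sym[OF G(1) arc[of m]] wn m by simp
  have "w m \<noteq> w (Suc 0)" using inj_onD[OF inj, of m "Suc 0"] m by auto
  then have nbs_0: "nbs G (w 0) = {w m, w (Suc 0)}"
    using two_nbs[OF wV, of 0] arc[of 0] arc_m
    by (smt (verit) Image_singleton_iff doubleton_eq_iff insert_iff singletonD)
  have w_mod: "w (Suc k mod n) = w (Suc k)" if "k < n" for k
    using that wn by (cases "Suc k = n") auto
  \<comment> \<open>Cyclic form of the neighbourhoods: the predecessor of index 0 is
    \<open>m = n - 1\<close>.\<close>
  have nbs_cyc: "nbs G (w k) = {w ((if k = 0 then m else k - 1)), w (Suc k)}" for k
    using nbs_w[of "k - 1"] nbs_0 by (cases k) auto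
  have surj: "x \<in> w ` {..<n}" if "x \<in> pverts G" for x
    using G wV[of 0] that
  proof (induction rule: connected_induct)
    case base show ?case using m by auto
  next
    case (step x y)
    then obtain k where k: "k < n" "x = w k" by auto
    then have "y = w (if k = 0 then m else k - 1) \<or> y = w (Suc k mod n)"
      using step.hyps nbs_cyc[of k] w_mod[of k] by auto
    moreover have "(if k = 0 then m else k - 1) < n" "Suc k mod n < n"
      using k m by auto
    ultimately show ?case by blast
  qed
  have "bij_betw w {..<n} (pverts G)"
    using inj surj wV by (auto simp: bij_betw_def)
  moreover have "(i, j) \<in> parcs (cycle_graph n) \<longleftrightarrow> (w i, w j) \<in> parcs G"
    if ij: "i < n" "j < n" for i j
  proof -
    define p where "p = (if i = 0 then m else i - 1)"
    have lt: "p < n" "Suc i mod n < n"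
      using ij m by (auto simp: p_def)
    have "nbs G (w i) = {w p, w (Suc i mod n)}"
      by (simp only: nbs_cyc p_def w_mod[OF ij(1)])
    then have "(w i, w j) \<in> parcs G \<longleftrightarrow> w j \<in> {w p, w (Suc i mod n)}"
      by (simp only: flip: Image_singleton_iff)
    also have "\<dots> \<longleftrightarrow> j = p \<or> j = Suc i mod n"
      using inj_on_eq_iff[OF inj, of j] ij lt by simp
    also have "j = p \<longleftrightarrow> i = Suc j mod n"
      using ij m by (auto simp: p_def mod_Suc)
    finally show ?thesis using ij by auto
  qed
  ultimately have "pair_iso w (cycle_graph n) G"
    by (simp add: pair_iso_def)
  with n3 show ?thesis by blast
qed

section \<open>Parity and homomorphisms of cycles\<close>

text \<open>Reduction modulo an even \<open>n\<close> preserves parity, so parity is a proper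
  two-colouring.\<close>

lemma even_cycle_two_coloring:
  assumes "even n" "(i, j) \<in> parcs (cycle_graph n)"
  shows "even i \<noteq> even j"
  using assms by (auto simp: mod_Suc split: if_splits)

text \<open>Integers replace naturals here so that the steps along a walk can be summed with their
  signs.\<close>

lemma cycle_arc_int:
  assumes "(i, j) \<in> parcs (cycle_graph n)"
  shows "\<exists>d\<in>{1, -1}. [int j = int i + d] (mod int n)"
proof -
  from assms consider "j = Suc i mod n" | "i = Suc j mod n" by auto
  then show ?thesis
  proof cases
    case 1
    then have "[int j = int i + 1] (mod int n)"
      by (simp add: cong_def zmod_int algebra_simps)
    then show ?thesis by blast
  next
    case 2
    then have "[int i = int j + 1] (mod int n)"
      by (simp add: cong_def zmod_int algebra_simps)
    then have "[int j = int i + -1] (mod int n)"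
      by (simp add: cong_iff_dvd_diff dvd_diff_commute algebra_simps)
    then show ?thesis by blast
  qed
qed

lemma odd_cycle_hom:
  assumes hom: "\<And>i j. (i, j) \<in> parcs (cycle_graph m) \<Longrightarrow> (h i, h j) \<in> parcs (cycle_graph n)"
    and m: "m \<ge> 3" "odd m"
  shows "odd n \<and> n \<le> m"
proof -
  \<comment> \<open>lift the closed walk \<open>h 0, h 1, \<dots>\<close> to the integers; its total displacement \<open>s\<close> is a
    multiple of \<open>n\<close>, and it is odd, so nonzero\<close>
  have "\<exists>s. [int (h (k mod m)) = int (h 0) + s] (mod int n) \<and> \<bar>s\<bar> \<le> int k \<and> even (s - int k)" for k
  proof (induction k)
    case 0 show ?case by (intro exI[of _ 0]) simp
  next
    case (Suc k)
    then obtain s where s: "[int (h (k mod m)) = int (h 0) + s] (mod int n)" "\<bar>s\<bar> \<le> int k"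
      "even (s - int k)" by blast
    have "(k mod m, Suc k mod m) \<in> parcs (cycle_graph m)"
      using m by (auto simp: mod_Suc_eq)
    from cycle_arc_int[OF hom[OF this]] obtain d where d: "d = 1 \<or> d = -1"
      "[int (h (Suc k mod m)) = int (h (k mod m)) + d] (mod int n)" by blast
    have "[int (h (Suc k mod m)) = int (h 0) + (s + d)] (mod int n)"
      using cong_trans[OF d(2) cong_add[OF s(1) cong_refl[of d]]] by (simp add: add.assoc)
    moreover have "\<bar>s + d\<bar> \<le> int (Suc k)" "even (s + d - int (Suc k))"
      using d(1) s(2,3) by auto
    ultimately show ?case by blast
  qed
  from this[of m] obtain s where s: "[int (h 0) = int (h 0) + s] (mod int n)" "\<bar>s\<bar> \<le> int m"
    "even (s - int m)" by auto
  have dvd: "int n dvd s"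
    using s(1) by (simp add: cong_iff_dvd_diff)
  have "odd s" using s(3) m by auto
  \<comment> \<open>A divisor of an odd number is odd. A nonzero multiple of \<open>n\<close> has
    absolute value at least \<open>n\<close>, while \<open>m\<close> unit steps reach at most
    \<open>m\<close>.\<close>
  with dvd have "odd (int n)" using dvd_trans by blast
  moreover have "s \<noteq> 0" using \<open>odd s\<close> by auto
  then have "int n \<le> \<bar>s\<bar>" using dvd_imp_le_int[OF _ dvd] by simp
  ultimately show ?thesis using s(2) by auto
qed

section \<open>Linear coordinates on the product of two odd cycles\<close>

lemma cycle_arc_iff_cong:
  assumes "i < n" "j < n"
  shows "(i, j) \<in> parcs (cycle_graph n) \<longleftrightarrow>
    int n dvd int j - int i - 1 \<or> int n dvd int j - int i + 1"
proof -
  have "j = Suc i mod n \<longleftrightarrow> [int j = int i + 1] (mod int n)"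
    using assms by (simp add: cong_def flip: of_nat_Suc zmod_int)
      (metis add.commute of_nat_Suc of_nat_eq_iff zmod_int)
  moreover have "i = Suc j mod n \<longleftrightarrow> [int i = int j + 1] (mod int n)"
    using assms by (simp add: cong_def flip: of_nat_Suc zmod_int)
      (metis add.commute of_nat_Suc of_nat_eq_iff zmod_int)
  moreover have "int n dvd int i - (int j + 1) \<longleftrightarrow> int n dvd int j - int i + 1"
    using dvd_minus_iff[of "int n" "int i - (int j + 1)"] by (simp add: algebra_simps)
  ultimately show ?thesis
    using assms by (simp add: cong_iff_dvd_diff algebra_simps)
qed

text \<open>Lets the reductions modulo \<open>n\<close> in the coordinates of the map below be
  dropped.\<close>

lemma dvd_of_nat_mod_diff:
  "int n dvd (int (a mod n) - int (b mod n)) - c \<longleftrightarrow> int n dvd (int a - int b) - c"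
proof -
  have "[int (a mod n) - int (b mod n) - c = int a - int b - c] (mod int n)"
    by (intro cong_diff) (simp_all add: cong_def zmod_int)
  then show ?thesis by (rule cong_dvd_iff)
qed

text \<open>The map turns a step \<open>d\<close> in the first coordinate into the pair of steps
  \<open>(d, d)\<close>, and a step \<open>d\<close> in the second into \<open>(d, -d)\<close>. For
  \<open>d\<close> equal to 1 or -1 these are all pairs of unit steps, that is, all Kronecker arcs.
  Oddness makes 2 invertible, so nothing is lost.\<close>

lemma odd_cycle_products_iso:
  assumes n: "n \<ge> 3" "odd n"
  shows "\<exists>f. pair_iso f (cartesian_product (cycle_graph n) (cycle_graph n))
    (kronecker_product (cycle_graph n) (cycle_graph n))"
proof -
  let ?C = "cycle_graph n" and ?N = "int n"
  \<comment> \<open>For \<open>y < n\<close>, \<open>n - y\<close> is a natural number that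
    represents \<open>-y\<close> modulo \<open>n\<close>.\<close>
  define f where "f = (\<lambda>(x, y). ((x + y) mod n, (x + (n - y)) mod n))"
  have zero: "x = x'" if "x < n" "x' < n" "?N dvd int x' - int x" for x x'
    using that by (metis cong_iff_dvd_diff cong_less_modulus_unique_nat cong_int_iff)
  have half: "?N dvd a" if "?N dvd 2 * a" for a
  proof -
    have "coprime ?N 2" using n(2) by (simp add: coprime_commute)
    then show ?thesis using that by (simp add: coprime_dvd_mult_right_iff)
  qed
  \<comment> \<open>The matrix with rows (1, 1) and (1, -1) is invertible modulo an odd
    \<open>n\<close>, its determinant being -2.\<close>
  have solve: "?N dvd p \<and> ?N dvd q \<longleftrightarrow> ?N dvd p + q \<and> ?N dvd p - q" for p q
  proof
    assume pq: "?N dvd p + q \<and> ?N dvd p - q"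
    then have "?N dvd (p + q) + (p - q)" "?N dvd (p + q) - (p - q)"
      using dvd_add dvd_diff by blast+
    then show "?N dvd p \<and> ?N dvd q" using half[of p] half[of q] by simp
  qed simp
  have diff1: "?N dvd int (fst (f (x', y'))) - int (fst (f (x, y))) - c \<longleftrightarrow>
      ?N dvd (int x' - int x) + (int y' - int y) - c" for x y x' y' c
    using dvd_of_nat_mod_diff[of n "x' + y'" "x + y" c] by (simp add: f_def algebra_simps)
  have diff2: "?N dvd int (snd (f (x', y'))) - int (snd (f (x, y))) - c \<longleftrightarrow>
      ?N dvd (int x' - int x) - (int y' - int y) - c" if "y < n" "y' < n" for x y x' y' c
    using dvd_of_nat_mod_diff[of n "x' + (n - y')" "x + (n - y)" c] that
    by (simp add: f_def algebra_simps of_nat_diff)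
  have arc_shift: "(i, j) \<in> parcs ?C \<longleftrightarrow> (\<exists>d\<in>{1, -1}. ?N dvd int j - int i - d)"
    if "i < n" "j < n" for i j
    using cycle_arc_iff_cong[OF that] by auto
  have f_lt: "fst (f p) < n" "snd (f p) < n" for p
    using n by (auto simp: f_def case_prod_beta)
  have inj: "inj_on f ({..<n} \<times> {..<n})"
  proof (rule inj_onI, clarsimp)
    fix x y x' y' assume V: "x < n" "y < n" "x' < n" "y' < n" and eq: "f (x, y) = f (x', y')"
    have "?N dvd (int x' - int x) + (int y' - int y)" "?N dvd (int x' - int x) - (int y' - int y)"
      using diff1[of x' y' x y 0] diff2[of y y' x' x 0] V eq by simp_all
    with solve have "?N dvd int x' - int x \<and> ?N dvd int y' - int y" by blast
    then show "x = x' \<and> y = y'" using zero V by simp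
  qed
  have sub: "f ` ({..<n} \<times> {..<n}) \<subseteq> {..<n} \<times> {..<n}"
    using n by (auto simp: f_def)
  have "bij_betw f ({..<n} \<times> {..<n}) ({..<n} \<times> {..<n})"
    using inj endo_inj_surj[OF _ sub inj] by (simp add: bij_betw_def)
  moreover have "((x, y), (x', y')) \<in> parcs (cartesian_product ?C ?C) \<longleftrightarrow>
      (f (x, y), f (x', y')) \<in> parcs (kronecker_product ?C ?C)"
    if V: "x < n" "y < n" "x' < n" "y' < n" for x y x' y'
  proof -
    define a b where "a = int x' - int x" and "b = int y' - int y"
    have "(f (x, y), f (x', y')) \<in> parcs (kronecker_product ?C ?C) \<longleftrightarrow>
        (fst (f (x, y)), fst (f (x', y'))) \<in> parcs ?C \<and>
        (snd (f (x, y)), snd (f (x', y'))) \<in> parcs ?C"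
      by (metis parcs_kronecker_product_iff prod.collapse)
    also have "\<dots> \<longleftrightarrow> (\<exists>d\<in>{1, -1}. ?N dvd a + b - d) \<and> (\<exists>d\<in>{1, -1}. ?N dvd a - b - d)"
      using arc_shift[OF f_lt(1) f_lt(1), of "(x, y)" "(x', y')"]
        arc_shift[OF f_lt(2) f_lt(2), of "(x, y)" "(x', y')"] V
      by (simp only: diff1 diff2 a_def b_def)
    also have "\<dots> \<longleftrightarrow> (\<exists>d\<in>{1, -1}. ?N dvd a - d \<and> ?N dvd b \<or> ?N dvd a \<and> ?N dvd b - d)"
    proof -
      \<comment> \<open>\<open>A\<close>: equal signs in the image come from a step in the first
        coordinate. \<open>B\<close>: opposite signs come from a step in the second.\<close>
      have A: "?N dvd a - d \<and> ?N dvd b \<longleftrightarrow> ?N dvd a + b - d \<and> ?N dvd a - b - d" for d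
        using solve[of "a - d" b] by (simp add: algebra_simps)
      have B: "?N dvd a \<and> ?N dvd b - d \<longleftrightarrow> ?N dvd a + b - d \<and> ?N dvd a - b - (- d)" for d
        using solve[of a "b - d"] by (simp add: algebra_simps)
      show ?thesis
        using A[of 1] A[of "-1"] B[of 1] B[of "-1"] unfolding bex_simps minus_minus by blast
    qed
    also have "\<dots> \<longleftrightarrow> ((x, y), (x', y')) \<in> parcs (cartesian_product ?C ?C)"
    proof -
      have "?N dvd a \<longleftrightarrow> x = x'" "?N dvd b \<longleftrightarrow> y = y'"
        using zero V by (auto simp: a_def b_def)
      then show ?thesis
        using arc_shift[of x x'] arc_shift[of y y'] V
        by (auto simp del: parcs_cycle_graph_iff simp: a_def b_def)
    qed
    finally show ?thesis by simp
  qed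
  ultimately have "pair_iso f (cartesian_product ?C ?C) (kronecker_product ?C ?C)"
    by (auto simp: pair_iso_def simp del: parcs_cartesian_product_iff)
  then show ?thesis by blast
qed

subsection \<open>Isomorphic products\<close>

lemma odd_cycle_of_length_iff:
  assumes "pair_graph G"
  shows "odd_cycle_of_length n G \<longleftrightarrow> n \<ge> 3 \<and> odd n \<and> (\<exists>f. pair_iso f G (cycle_graph n))"
  using digraph_iso_iff_pair_iso[OF assms pair_graph_cycle_graph]
  by (auto simp: odd_cycle_of_length_def)

lemma products_iso_imp_odd_cycles:
  assumes G: "pair_graph G" "connected (with_proj G)"
    and H: "pair_graph H" "connected (with_proj H)"
    and nontriv: "\<not> (card (pverts G) = 1 \<and> card (pverts H) = 1)"
    and F: "pair_iso F (cartesian_product G H) (kronecker_product G H)"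
  shows "\<exists>n. odd_cycle_of_length n G \<and> odd_cycle_of_length n H"
proof -
  note reg = two_regular_if_iso_products[OF G H nontriv F]
  obtain m f where m: "m \<ge> 3" and f: "pair_iso f (cycle_graph m) G"
    using connected_two_regular_imp_cycle[OF G] reg by blast
  obtain n g where n: "n \<ge> 3" and g: "pair_iso g (cycle_graph n) H"
    using connected_two_regular_imp_cycle[OF H] reg by blast
  define f' g' where "f' = the_inv_into {..<m} f" and "g' = the_inv_into {..<n} g"
  have f': "pair_iso f' G (cycle_graph m)" and g': "pair_iso g' H (cycle_graph n)"
    using pair_iso_inv[OF f] pair_iso_inv[OF g] by (simp_all add: f'_def g'_def)
  have Farc: "(fst (F p), fst (F q)) \<in> parcs G \<and> (snd (F p), snd (F q)) \<in> parcs H"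
    if "(p, q) \<in> parcs (cartesian_product G H)" for p q
    using pair_iso_arc[OF F pair_graph_cartesian_product[OF G(1) H(1)] that]
    by (metis parcs_kronecker_product_iff prod.collapse)
  have f0: "f 0 \<in> pverts G" and g0: "g 0 \<in> pverts H"
    using pair_iso_in_verts[OF f] pair_iso_in_verts[OF g] m n by simp_all
  \<comment> \<open>\<open>i\<close> runs through the copy of \<open>G\<close> with second
    coordinate \<open>g 0\<close>. \<open>F\<close> sends its arcs to Kronecker arcs, which project
    to arcs of \<open>H\<close>; this is a homomorphism from \<open>cycle_graph m\<close> to
    \<open>cycle_graph n\<close>.\<close>
  have "(g' (snd (F (f i, g 0))), g' (snd (F (f j, g 0)))) \<in> parcs (cycle_graph n)"
    if "(i, j) \<in> parcs (cycle_graph m)" for i j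
    using pair_iso_arc[OF g' H(1)] Farc g0 pair_iso_arc[OF f pair_graph_cycle_graph[OF m] that]
    by (simp del: parcs_cycle_graph_iff)
  then have mn: "odd m \<Longrightarrow> odd n \<and> n \<le> m"
    using odd_cycle_hom[of m "\<lambda>i. g' (snd (F (f i, g 0)))" n] m by blast
  have "(f' (fst (F (f 0, g i))), f' (fst (F (f 0, g j)))) \<in> parcs (cycle_graph m)"
    if "(i, j) \<in> parcs (cycle_graph n)" for i j
    using pair_iso_arc[OF f' G(1)] Farc f0 pair_iso_arc[OF g pair_graph_cycle_graph[OF n] that]
    by (simp del: parcs_cycle_graph_iff)
  then have nm: "odd n \<Longrightarrow> odd m \<and> m \<le> n"
    using odd_cycle_hom[of n "\<lambda>i. f' (fst (F (f 0, g i)))" m] n by blast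
  have "odd m \<or> odd n"
  proof (rule ccontr)
    assume "\<not> (odd m \<or> odd n)"
    then have ev: "even m" "even n" by auto
    \<comment> \<open>\<open>c\<close> compares the parities of the two cycle positions. A Kronecker
      arc flips both, so \<open>c\<close> is constant along it and, by connectedness of the
      Cartesian product, on the whole image of \<open>F\<close>.\<close>
    define c where "c = (\<lambda>(x, y). even (f' x) = even (g' y))"
    have "c (F p) = c (F q)" if "(p, q) \<in> parcs (cartesian_product G H)" for p q
      using Farc[OF that] pair_iso_arc[OF f' G(1)] pair_iso_arc[OF g' H(1)]
        even_cycle_two_coloring[OF ev(1)] even_cycle_two_coloring[OF ev(2)]
      unfolding c_def case_prod_beta by blast
    from cartesian_product_constant[OF G H this, of "\<lambda>p. p"]
    have const: "c (F p) = c (F q)" if "p \<in> pverts G \<times> pverts H" "q \<in> pverts G \<times> pverts H" for p q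
      using that by blast
    obtain x where x: "(f 0, x) \<in> parcs G"
      using reg f0 by (fastforce simp: card_2_iff)
    then have xV: "x \<in> pverts G" by (rule pair_graph_head_in_verts[OF G(1)])
    \<comment> \<open>\<open>F\<close> is onto, so \<open>c\<close> is constant on all vertices; yet
      moving only the first coordinate to a neighbour flips just one parity.\<close>
    have "c (f 0, g 0) = c (x, g 0)"
      using const pair_iso_surj[OF F, of "(f 0, g 0)"] pair_iso_surj[OF F, of "(x, g 0)"]
        f0 g0 xV by auto
    moreover have "even (f' (f 0)) \<noteq> even (f' x)"
      using even_cycle_two_coloring[OF ev(1) pair_iso_arc[OF f' G(1) x]] .
    ultimately show False by (auto simp: c_def)
  qed
  then have "odd m" "n = m" using mn nm by (blast intro: antisym)+
  then have "odd_cycle_of_length m G" "odd_cycle_of_length m H"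
    using m f' g' G(1) H(1) by (simp_all only: odd_cycle_of_length_iff) blast+
  then show ?thesis by blast
qed

text \<open>Pass to the product of the cycles through the isomorphisms of the factors, apply the
  isomorphism found there, and return through the inverse on the Kronecker side.\<close>

lemma products_iso_if_odd_cycles:
  assumes "pair_iso f G (cycle_graph n)" "pair_iso g H (cycle_graph n)" "n \<ge> 3" "odd n"
  shows "\<exists>F. pair_iso F (cartesian_product G H) (kronecker_product G H)"
proof -
  obtain h where h: "pair_iso h (cartesian_product (cycle_graph n) (cycle_graph n))
      (kronecker_product (cycle_graph n) (cycle_graph n))"
    using odd_cycle_products_iso assms by blast
  note pair_iso_comp[OF pair_iso_comp[OF pair_iso_cartesian_product[OF assms(1,2)] h]
      pair_iso_inv[OF pair_iso_kronecker_product[OF assms(1,2)]]]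
  then show ?thesis by blast
qed

theorem theorem3p1:
  fixes G :: "'a pair_pre_digraph" and H :: "'b pair_pre_digraph"
  assumes "pair_graph G" and "connected (with_proj G)"
    and "pair_graph H" and "connected (with_proj H)"
    and "\<not> (card (pverts G) = 1 \<and> card (pverts H) = 1)"
  shows "digraph_iso (with_proj (cartesian_product G H)) (with_proj (kronecker_product G H))
    \<longleftrightarrow> (\<exists>n. odd_cycle_of_length n G \<and> odd_cycle_of_length n H)"
proof -
  have "digraph_iso (with_proj (cartesian_product G H)) (with_proj (kronecker_product G H)) \<longleftrightarrow>
      (\<exists>F. pair_iso F (cartesian_product G H) (kronecker_product G H))"
    using assms(1,3) digraph_iso_iff_pair_iso pair_graph_cartesian_product
      pair_graph_kronecker_product by blast
  also have "\<dots> \<longleftrightarrow> (\<exists>n. odd_cycle_of_length n G \<and> odd_cycle_of_length n H)"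
    using products_iso_imp_odd_cycles[OF assms] products_iso_if_odd_cycles
      odd_cycle_of_length_iff[OF assms(1)] odd_cycle_of_length_iff[OF assms(3)] by metis
  finally show ?thesis .
qed

end
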